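(* Let $E$ be a Banach space, $\mathcal D$ a domain in $E$, and $\Phi^X_t$ a dynamical system on $E$ with vector field $X:\mathcal D\to E$. Let $F\in C^2(E,\mathbb R^m)$ be a vector of constants of the motion for $\Phi_t^X$ with level sets $\Sigma_\mu=\{u\in E\mid F(u)=\mu\}$, and let $G$ be an invariance group of $\Phi_t^X$, with action $\Phi$ on $E$. Let $\mu_*\in\mathbb R^m$ and put $G_{\Sigma_{\mu_*}}=\{g\in G\mid\Phi_g\Sigma_{\mu_*}=\Sigma_{\mu_*}\}$. Suppose there exist $u_{\mu_*}\in\Sigma_{\mu_*}$ which is a relative equilibrium of the dynamics for the group $G_{\Sigma_{\mu_*}}$, and $\mathcal L_{\mu_*}\in C(E,\mathbb R)$ which is a $G_{\Sigma_{\mu_*}}$-invariant constant of the motion. Let $\mathcal O_{u_{\mu_*}}=\{\Phi_g(u_{\mu_*})\mid g\in G_{\Sigma_{\mu_*}}\}$. Suppose there exist $\eta>0$, $c>0$ such that $$\forall u\in\mathcal O_{u_{\mu_*}},\ \forall v\in E,\quad \mathrm d(v,u)\le\eta\ \Rightarrow\ \mathcal L_{\mu_*}(v)-\mathcal L_{\mu_*}(u)\ge c\,\mathrm d^2(v,\mathcal O_{u_{\mu_*}}).$$ Then all $u\in\mathcal O_{u_{\mu_*}}$ are orbitally stable $G_{\Sigma_{\mu_*}}$-relative equilibria.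
   Context: A domain $\mathcal D$ in $E$ is a dense subset of $E$. A dynamical system on $E$ with vector field $X:\mathcal D\to E$ is a separately continuous map $\Phi^X:\mathbb R\times E\to E$, $(t,u)\mapsto\Phi_t^X(u)$, with $\Phi_t^X\circ\Phi_s^X=\Phi_{t+s}^X$, $\Phi_0^X=\mathrm{Id}_E$, $\Phi_t^X(\mathcal D)=\mathcal D$, and such that for $u\in\mathcal D$ the curve $u(t)=\Phi_t^X(u)$ is differentiable as a map $\mathbb R\to E$ and satisfies $\dot u(t)=X(u(t))$, $u(0)=u$. For any $v\in E$ one writes $v(t)=\Phi_t^X(v)$. A function $F$ on $E$ is a constant of the motion if $F\circ\Phi_t^X=F$ for all $t\in\mathbb R$ (for vector-valued $F$, each component). An action of a topological group $G$ on $E$ is a separately continuous map $(g,u)\mapsto\Phi_g(u)$ with $\Phi_e=\mathrm{Id}$, $\Phi_{g_1g_2}=\Phi_{g_1}\circ\Phi_{g_2}$; $G$ is an invariance group for $\Phi_t^X$ if $\Phi_g\circ\Phi_t^X=\Phi_t^X\circ\Phi_g$ for all $g\in G$, $t\in\mathbb R$. $\mathrm d(u,v)=\|u-v\|$ and $\mathrm d(u,S)=\inf_{v\in S}\mathrm d(u,v)$. For a subgroup $\tilde G\subset G$ and $u\in E$, let $\mathcal O_u=\{\Phi_g(u)\mid g\in\tilde G\}$. $u$ is a $\tilde G$-relative equilibrium if $u(t)\in\mathcal O_u$ for all $t\in\mathbb R$. $u$ is orbitally stable (with respect to $\tilde G$) if for all $\epsilon>0$ there is $\delta>0$ such that for all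 $v\in E$: $\mathrm d(v,u)\le\delta\Rightarrow\forall t\in\mathbb R,\ \inf_{t'\in\mathbb R}\mathrm d(v(t),\mathcal O_{u(t')})\le\epsilon$. (Here $\tilde G=G_{\Sigma_{\mu_*}}$; when $u$ is a relative equilibrium $\mathcal O_{u(t')}=\mathcal O_u$.) *)

theory Defs
  imports "HOL-Analysis.Analysis" "HOL-Algebra.Group_Action"
begin

section \<open>Dynamical systems\<close>

text \<open>The vector field is a total function \<open>X\<close>; only its values on the dense set \<open>D\<close> are used.\<close>

definition dynamical_system ::
  "'a::banach set \<Rightarrow> ('a \<Rightarrow> 'a) \<Rightarrow> (real \<Rightarrow> 'a \<Rightarrow> 'a) \<Rightarrow> bool" where
  "dynamical_system D X \<phi> \<longleftrightarrow>
     closure D = UNIV \<and>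
     (\<forall>t. continuous_on UNIV (\<phi> t)) \<and>
     (\<forall>u. continuous_on UNIV (\<lambda>t. \<phi> t u)) \<and>
     (\<forall>t s. \<phi> t \<circ> \<phi> s = \<phi> (t + s)) \<and>
     \<phi> 0 = id \<and>
     (\<forall>t. \<phi> t ` D = D) \<and>
     (\<forall>u\<in>D. \<forall>t. ((\<lambda>t. \<phi> t u) has_vector_derivative X (\<phi> t u)) (at t))"

definition constant_of_motion :: "(real \<Rightarrow> 'a \<Rightarrow> 'a) \<Rightarrow> ('a \<Rightarrow> 'b) \<Rightarrow> bool" where
  "constant_of_motion \<phi> F \<longleftrightarrow> (\<forall>t. F \<circ> \<phi> t = F)"

definition level_set :: "('a \<Rightarrow> 'b) \<Rightarrow> 'b \<Rightarrow> 'a set" where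
  "level_set F \<mu> = {u. F u = \<mu>}"

text \<open>\<open>C\<^sup>2\<close> in the Frechet sense, the derivatives taking values in spaces of bounded linear maps
  with the operator norm.\<close>

definition C2 :: "('a::real_normed_vector \<Rightarrow> 'b::real_normed_vector) \<Rightarrow> bool" where
  "C2 F \<longleftrightarrow>
     (\<exists>(F' :: 'a \<Rightarrow> 'a \<Rightarrow>\<^sub>L 'b) (F'' :: 'a \<Rightarrow> 'a \<Rightarrow>\<^sub>L ('a \<Rightarrow>\<^sub>L 'b)).
        (\<forall>u. (F has_derivative blinfun_apply (F' u)) (at u)) \<and>
        (\<forall>u. (F' has_derivative blinfun_apply (F'' u)) (at u)) \<and>
        continuous_on UNIV F'')"

section \<open>Group actions\<close>

locale topological_group = group G for G (structure) +
  fixes T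
  assumes topspace_eq: "topspace T = carrier G"
    and continuous_mult: "continuous_map (prod_topology T T) T (\<lambda>(x, y). x \<otimes> y)"
    and continuous_inv: "continuous_map T T (\<lambda>x. inv x)"

definition topological_action ::
  "('g, 'x) monoid_scheme \<Rightarrow> 'g topology \<Rightarrow> ('g \<Rightarrow> 'a::topological_space \<Rightarrow> 'a) \<Rightarrow> bool" where
  "topological_action G T \<Phi> \<longleftrightarrow>
     group_action G UNIV \<Phi> \<and>
     (\<forall>g\<in>carrier G. continuous_on UNIV (\<Phi> g)) \<and>
     (\<forall>u. continuous_map T euclidean (\<lambda>g. \<Phi> g u))"

lemma group_action_UNIV_iff:
  fixes G (structure)
  assumes "group G"
  shows "group_action G UNIV \<Phi> \<longleftrightarrow>
    \<Phi> \<one> = id \<and>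
    (\<forall>g\<in>carrier G. \<forall>h\<in>carrier G. \<Phi> (g \<otimes> h) = \<Phi> g \<circ> \<Phi> h)" (is "?L \<longleftrightarrow> ?R")
proof
  interpret group G by (rule assms)
  assume ?L
  then interpret group_action G UNIV \<Phi> .
  show ?R
  proof (intro conjI ballI)
    show "\<Phi> \<one> = id" using id_eq_one by (auto simp: fun_eq_iff)
    show "\<Phi> (g \<otimes> h) = \<Phi> g \<circ> \<Phi> h" if "g \<in> carrier G" "h \<in> carrier G" for g h
      using composition_rule that by (auto simp: fun_eq_iff)
  qed
next
  interpret group G by (rule assms)
  assume R: ?R
  have bij: "\<Phi> g \<in> Bij UNIV" if "g \<in> carrier G" for g
  proof -
    have "\<Phi> g \<circ> \<Phi> (inv g) = id" "\<Phi> (inv g) \<circ> \<Phi> g = id"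
      using R that by (metis inv_closed r_inv, metis inv_closed l_inv)
    then have "bij (\<Phi> g)" using o_bij by blast
    then show ?thesis by (simp add: Bij_def)
  qed
  have "\<Phi> \<in> hom G (BijGroup UNIV)"
    using R bij by (auto simp: hom_def BijGroup_def compose_def fun_eq_iff)
  then show ?L
    by (simp add: group_action_def group_hom_def group_hom_axioms_def group_BijGroup assms)
qed

definition invariance_group ::
  "('g, 'x) monoid_scheme \<Rightarrow> 'g topology \<Rightarrow> ('g \<Rightarrow> 'a::topological_space \<Rightarrow> 'a)
    \<Rightarrow> (real \<Rightarrow> 'a \<Rightarrow> 'a) \<Rightarrow> bool" where
  "invariance_group G T \<Phi> \<phi> \<longleftrightarrow>
     topological_group G T \<and>
     topological_action G T \<Phi> \<and>
     (\<forall>g\<in>carrier G. \<forall>t. \<Phi> g \<circ> \<phi> t = \<phi> t \<circ> \<Phi> g)"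

text \<open>The subgroup of \<open>G\<close> preserving \<open>S\<close>, as a group record like \<open>G\<close> itself, so that \<open>orbit\<close>
  applies to it.\<close>

definition preserving_group ::
  "('g, 'x) monoid_scheme \<Rightarrow> ('g \<Rightarrow> 'a \<Rightarrow> 'a) \<Rightarrow> 'a set \<Rightarrow> ('g, 'x) monoid_scheme" where
  "preserving_group G \<Phi> S = G\<lparr>carrier := {g \<in> carrier G. \<Phi> g ` S = S}\<rparr>"

lemma subgroup_preserving_group:
  fixes G (structure)
  assumes "group G" "group_action G UNIV \<Phi>"
  shows "subgroup (carrier (preserving_group G \<Phi> S)) G"
proof -
  interpret group G by (rule assms)
  have one: "\<Phi> \<one> = id"
    and mult: "\<And>g h. g \<in> carrier G \<Longrightarrow> h \<in> carrier G \<Longrightarrow> \<Phi> (g \<otimes> h) = \<Phi> g \<circ> \<Phi> h"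
    using assms group_action_UNIV_iff by blast+
  have "\<Phi> (inv g) ` S = S" if "g \<in> carrier G" "\<Phi> g ` S = S" for g
  proof -
    have "\<Phi> (inv g) ` (\<Phi> g ` S) = S"
      using mult[of "inv g" g] one that(1) by (simp add: image_comp)
    then show ?thesis using that(2) by simp
  qed
  moreover have "\<Phi> (g \<otimes> h) ` S = S"
    if "g \<in> carrier G" "\<Phi> g ` S = S" "h \<in> carrier G" "\<Phi> h ` S = S" for g h
    using that by (simp only: mult image_comp[symmetric])
  ultimately show ?thesis
    by unfold_locales (simp_all add: preserving_group_def one subset_iff)
qed

definition invariant_under ::
  "('g, 'x) monoid_scheme \<Rightarrow> ('g \<Rightarrow> 'a \<Rightarrow> 'a) \<Rightarrow> ('a \<Rightarrow> 'b) \<Rightarrow> bool" where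
  "invariant_under H \<Phi> L \<longleftrightarrow> (\<forall>g\<in>carrier H. L \<circ> \<Phi> g = L)"

section \<open>Relative equilibria and orbital stability\<close>

definition relative_equilibrium ::
  "('g, 'x) monoid_scheme \<Rightarrow> ('g \<Rightarrow> 'a \<Rightarrow> 'a) \<Rightarrow> (real \<Rightarrow> 'a \<Rightarrow> 'a) \<Rightarrow> 'a \<Rightarrow> bool" where
  "relative_equilibrium H \<Phi> \<phi> u \<longleftrightarrow> (\<forall>t. \<phi> t u \<in> orbit H \<Phi> u)"

definition orbitally_stable ::
  "('g, 'x) monoid_scheme \<Rightarrow> ('g \<Rightarrow> 'a::metric_space \<Rightarrow> 'a) \<Rightarrow> (real \<Rightarrow> 'a \<Rightarrow> 'a) \<Rightarrow> 'a \<Rightarrow> bool" where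
  "orbitally_stable H \<Phi> \<phi> u \<longleftrightarrow>
     (\<forall>\<epsilon>>0. \<exists>\<delta>>0. \<forall>v. dist v u \<le> \<delta> \<longrightarrow>
        (\<forall>t. (INF t'. infdist (\<phi> t v) (orbit H \<Phi> (\<phi> t' u))) \<le> \<epsilon>))"

end

theory Submission
  imports Defs
begin

text \<open>The value of \<open>L\<close> is the same on the whole orbit and along every trajectory. A trajectory that
  starts close to the orbit and reaches distance \<open>r\<close> from it must, by continuity, be at distance exactly
  \<open>r < \<eta>\<close> at some time; there the coercivity estimate bounds the excess of \<open>L\<close> below by
  \<open>c * r\<^sup>2\<close>, although this excess is arbitrarily small initially.\<close>

text \<open>Makes the orbit relation of the stabilizer of \<open>S\<close> available as an
  equivalence relation.\<close>

lemma group_action_preserving_group: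
  fixes G (structure)
  assumes "group G" "group_action G UNIV \<Phi>"
  shows "group_action (preserving_group G \<Phi> S) UNIV \<Phi>"
proof -
  interpret group G by (rule assms)
  have "group (preserving_group G \<Phi> S)"
    using subgroup.subgroup_is_group[OF subgroup_preserving_group[OF assms, of S] assms(1)]
    by (simp add: preserving_group_def)
  moreover have "\<Phi> \<one> = id"
    and "\<forall>g\<in>carrier G. \<forall>h\<in>carrier G. \<Phi> (g \<otimes> h) = \<Phi> g \<circ> \<Phi> h"
    using assms(2) unfolding group_action_UNIV_iff[OF assms(1)] by auto
  ultimately show ?thesis
    by (subst group_action_UNIV_iff) (simp_all add: preserving_group_def)
qed

text \<open>Transitivity of the orbit relation gives one inclusion; combined with symmetry it gives
  the other.\<close>

lemma (in group_action) orbit_eq: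
  assumes "x \<in> E" "y \<in> orbit G \<phi> x"
  shows "orbit G \<phi> y = orbit G \<phi> x"
proof -
  have "y \<in> E" using assms element_image by (auto simp: orbit_def)
  have "orbit G \<phi> x \<subseteq> E" "orbit G \<phi> y \<subseteq> E"
    using assms(1) \<open>y \<in> E\<close> element_image by (auto simp: orbit_def)
  then show ?thesis
    using orbit_trans[OF assms(1) \<open>y \<in> E\<close> _ assms(2)]
      orbit_trans[OF \<open>y \<in> E\<close> assms(1) _ orbit_sym[OF assms(1) \<open>y \<in> E\<close> assms(2)]]
    by auto
qed

text \<open>Since the flow commutes with the action, the trajectory of \<open>\<Phi> g w\<close> is
  the translate by \<open>g\<close> of the trajectory of \<open>w\<close>, which never leaves the
  orbit.\<close>

lemma relative_equilibrium_orbit: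
  assumes "group_action H UNIV \<Phi>"
    and comm: "\<And>g t. g \<in> carrier H \<Longrightarrow> \<Phi> g \<circ> \<phi> t = \<phi> t \<circ> \<Phi> g"
    and "relative_equilibrium H \<Phi> \<phi> w" "u \<in> orbit H \<Phi> w"
  shows "relative_equilibrium H \<Phi> \<phi> u"
  unfolding relative_equilibrium_def
proof
  fix t
  obtain g where g: "g \<in> carrier H" "u = \<Phi> g w"
    using assms(4) by (auto simp: orbit_def)
  have "\<phi> t u = \<Phi> g (\<phi> t w)"
    using comm[OF g(1), of t] g(2) by (simp add: fun_eq_iff)
  then have "\<phi> t u \<in> orbit H \<Phi> (\<phi> t w)"
    using g(1) by (auto simp: orbit_def)
  also have "\<dots> = orbit H \<Phi> w"
    using assms(3) by (intro group_action.orbit_eq[OF assms(1)]) (auto simp: relative_equilibrium_def)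
  also have "\<dots> = orbit H \<Phi> u"
    using group_action.orbit_eq[OF assms(1) _ assms(4)] by simp
  finally show "\<phi> t u \<in> orbit H \<Phi> u" .
qed

text \<open>The stability argument separated from the group: \<open>S\<close> stands for the orbit.
  The constants \<open>\<eta>\<close> and \<open>c\<close> are uniform over \<open>S\<close> because
  the trajectory may drift along \<open>S\<close>, and the estimate is applied at a point
  \<open>w\<close> possibly far from \<open>u\<close>.\<close>

lemma coercive_imp_stays_near:
  fixes \<phi> :: "real \<Rightarrow> 'a::metric_space \<Rightarrow> 'a" and L :: "'a \<Rightarrow> real"
  assumes cont: "\<And>v. continuous_on UNIV (\<lambda>t. \<phi> t v)"
    and "\<phi> 0 = id"
    and "isCont L u"
    and "constant_of_motion \<phi> L"
    and "u \<in> S"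
    and L_const: "\<And>w. w \<in> S \<Longrightarrow> L w = L u"
    and "\<eta> > 0" "c > 0"
    and coercive: "\<And>w v. w \<in> S \<Longrightarrow> dist v w \<le> \<eta> \<Longrightarrow> L v - L w \<ge> c * (infdist v S)\<^sup>2"
    and "\<epsilon> > 0"
  shows "\<exists>\<delta>>0. \<forall>v. dist v u \<le> \<delta> \<longrightarrow> (\<forall>t. infdist (\<phi> t v) S \<le> \<epsilon>)"
proof -
  \<comment> \<open>Crossing level: reached by any trajectory leaving the
    \<open>\<epsilon>\<close>-tube, yet strictly inside the range of the coercivity
    estimate.\<close>
  define r where "r = min \<epsilon> (\<eta> / 2)"
  have r: "0 < r" "r \<le> \<epsilon>" "r < \<eta>" using \<open>\<eta> > 0\<close> \<open>\<epsilon> > 0\<close> by (auto simp: r_def)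
  have "c * r\<^sup>2 > 0" using r \<open>c > 0\<close> by simp
  then obtain d where d: "d > 0" "\<And>v. dist v u < d \<Longrightarrow> dist (L v) (L u) < c * r\<^sup>2"
    using \<open>isCont L u\<close> unfolding continuous_at_eps_delta by blast
  \<comment> \<open>Halving turns the non-strict bound \<open>dist v u \<le> \<delta>\<close> into
    the strict one required by the choice of \<open>d\<close>.\<close>
  define \<delta> where "\<delta> = min d r / 2"
  have \<delta>: "0 < \<delta>" "\<delta> < d" "\<delta> < r" using d(1) r by (auto simp: \<delta>_def)
  have "infdist (\<phi> t v) S \<le> \<epsilon>" if v: "dist v u \<le> \<delta>" for t v
  proof (rule ccontr)
    assume far: "\<not> infdist (\<phi> t v) S \<le> \<epsilon>"
    define f where "f = (\<lambda>s. infdist (\<phi> s v) S)"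
    have "infdist v S \<le> dist v u" using \<open>u \<in> S\<close> by (rule infdist_le)
    then have near: "f 0 \<le> r" using v \<delta> \<open>\<phi> 0 = id\<close> by (simp add: f_def)
    have far': "r \<le> f t" using far r(2) by (simp add: f_def)
    \<comment> \<open>Connectedness of the whole range handles both signs of \<open>t\<close> at
      once.\<close>
    have "connected (range f)"
      unfolding f_def by (intro connected_continuous_image continuous_on_infdist cont connected_UNIV)
    then have "r \<in> range f"
      using near far' unfolding connected_iff_interval by blast
    then obtain s where s: "infdist (\<phi> s v) S = r" by (auto simp: f_def)
    have bdd: "bdd_below (dist (\<phi> s v) ` S)" by (auto intro: bdd_belowI2[where m = 0])
    have ne: "S \<noteq> {}" using \<open>u \<in> S\<close> by auto
    \<comment> \<open>The infimum need not be attained; the strict inequality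
      \<open>r < \<eta>\<close> still provides some \<open>w\<close> in \<open>S\<close> closer than
      \<open>\<eta>\<close>.\<close>
    have "(INF w\<in>S. dist (\<phi> s v) w) < \<eta>"
      using s r by (simp add: infdist_notempty[OF ne])
    then obtain w where w: "w \<in> S" "dist (\<phi> s v) w < \<eta>"
      unfolding cINF_less_iff[OF ne bdd] by auto
    have "c * r\<^sup>2 \<le> L (\<phi> s v) - L w" using coercive[of w "\<phi> s v"] w s by simp
    \<comment> \<open>Conservation of \<open>L\<close> moves the first term back to time 0, and
      constancy of \<open>L\<close> on \<open>S\<close> replaces \<open>w\<close> by
      \<open>u\<close>.\<close>
    also have "\<dots> = L v - L u"
      using \<open>constant_of_motion \<phi> L\<close> L_const[OF w(1)]
      by (simp add: constant_of_motion_def fun_eq_iff)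
    also have "\<dots> < c * r\<^sup>2" using d(2)[of v] v \<delta> by (simp add: dist_real_def)
    finally show False by simp
  qed
  then show ?thesis using \<delta>(1) by blast
qed

theorem theorem8p2:
  fixes D :: "'a::banach set"
    and X :: "'a \<Rightarrow> 'a"
    and \<phi> :: "real \<Rightarrow> 'a \<Rightarrow> 'a"
    and F :: "'a \<Rightarrow> real ^ 'm"
    and G :: "('g, 'x) monoid_scheme"
    and T :: "'g topology"
    and \<Phi> :: "'g \<Rightarrow> 'a \<Rightarrow> 'a"
    and \<mu> :: "real ^ 'm"
    and u\<^sub>\<mu> :: 'a
    and L :: "'a \<Rightarrow> real"
    and \<eta> c :: real
  defines "H \<equiv> preserving_group G \<Phi> (level_set F \<mu>)"
  assumes "dynamical_system D X \<phi>"
    and "C2 F"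
    and "constant_of_motion \<phi> F"
    and "invariance_group G T \<Phi> \<phi>"
    and "u\<^sub>\<mu> \<in> level_set F \<mu>"
    and "relative_equilibrium H \<Phi> \<phi> u\<^sub>\<mu>"
    and "continuous_on UNIV L"
    and "invariant_under H \<Phi> L"
    and "constant_of_motion \<phi> L"
    and "\<eta> > 0"
    and "c > 0"
    and "\<forall>u \<in> orbit H \<Phi> u\<^sub>\<mu>. \<forall>v. dist v u \<le> \<eta> \<longrightarrow>
           L v - L u \<ge> c * (infdist v (orbit H \<Phi> u\<^sub>\<mu>))\<^sup>2"
  shows "\<forall>u \<in> orbit H \<Phi> u\<^sub>\<mu>. relative_equilibrium H \<Phi> \<phi> u \<and> orbitally_stable H \<Phi> \<phi> u"
proof
  fix u assume u: "u \<in> orbit H \<Phi> u\<^sub>\<mu>"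
  let ?O = "orbit H \<Phi> u\<^sub>\<mu>"
  have G: "group G" "group_action G UNIV \<Phi>"
    using assms(5) by (auto simp: invariance_group_def topological_group_def topological_action_def)
  then have act: "group_action H UNIV \<Phi>"
    unfolding H_def by (rule group_action_preserving_group)
  have "\<Phi> g \<circ> \<phi> t = \<phi> t \<circ> \<Phi> g" if "g \<in> carrier H" for g t
    using assms(5) that by (simp add: invariance_group_def H_def preserving_group_def)
  from relative_equilibrium_orbit[OF act this assms(7) u]
  have eq: "relative_equilibrium H \<Phi> \<phi> u" .
  \<comment> \<open>Hence the infimum over \<open>t'\<close> in the definition of orbital stability
    is that of a constant, namely the distance to the single orbit \<open>?O\<close>.\<close>
  have orb: "orbit H \<Phi> (\<phi> t u) = ?O" for t
    using eq group_action.orbit_eq[OF act UNIV_I, of _ u] group_action.orbit_eq[OF act UNIV_I u]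
    by (simp add: relative_equilibrium_def)
  have L_const: "L w = L u\<^sub>\<mu>" if "w \<in> ?O" for w
    using that assms(9) by (auto simp: orbit_def invariant_under_def fun_eq_iff)
  have "\<exists>\<delta>>0. \<forall>v. dist v u \<le> \<delta> \<longrightarrow> (\<forall>t. infdist (\<phi> t v) ?O \<le> \<epsilon>)" if "\<epsilon> > 0" for \<epsilon>
  proof (rule coercive_imp_stays_near[where \<eta> = \<eta> and c = c])
    show "continuous_on UNIV (\<lambda>t. \<phi> t v)" for v
      using assms(2) by (simp add: dynamical_system_def)
    show "\<phi> 0 = id" using assms(2) by (simp add: dynamical_system_def)
    show "isCont L u" using assms(8) by (simp add: continuous_on_eq_continuous_at)
    show "L w = L u" if "w \<in> ?O" for w using L_const that u by simp
  qed (use assms u that in auto)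
  then have "orbitally_stable H \<Phi> \<phi> u"
    by (simp add: orbitally_stable_def orb)
  with eq show "relative_equilibrium H \<Phi> \<phi> u \<and> orbitally_stable H \<Phi> \<phi> u" ..
qed

end
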